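(* Let $X:U\subset\mathbb{R}^2\to\mathbb{R}^3$, $X(s,u)=\beta(s)+u\,w(s)$, be a non-cylindrical ruled surface in $\mathbb{R}^3$, where $\beta$ is a smooth curve in $\mathbb{R}^3$ and $|w|=1$; it is parameterized by its line of striction, i.e. $w'(s)\neq 0$ and $\langle\beta'(s),w'(s)\rangle=0$ for all $s$, and normalized so that $|w'(s)|=1$ for all $s$. Suppose that $\widehat X^{t}(s,u)=\sigma(t)\Gamma(t)X(s,u)+\Theta(t)$ is a self-similar solution to the mean curvature flow with $\widehat X^0=X$, where $L(t)=\sigma(t)\Gamma(t)+\Theta(t)$ is a homothetic helicoidal motion of $\mathbb{R}^3$. Then $X$ is trivial, i.e. $X$ is a minimal surface (its mean curvature $H$ vanishes identically).
   Context: All maps are smooth, $U\subset\mathbb{R}^2$ is open and connected, and surfaces are immersions. For an immersed surface $X(s,u)$ in $\mathbb{R}^3$ with unit normal $N$, first fundamental form coefficients $E,F,G$ and second fundamental form coefficients $e=\langle N,X_{ss}\rangle$, $f=\langle N,X_{su}\rangle$, $g=\langle N,X_{uu}\rangle$, the mean curvature is $H=\dfrac{Eg-2fF+Ge}{2(EG-F^2)}$. A homothetic helicoidal motion is a one-parameter family of maps $L(t)x=\sigma(t)\Gamma(t)x+\Theta(t)$, $t\in\mathfrak I$ (an interval containing $0$), with $\sigma:\mathfrak I\to(0,\infty)$, $\Gamma:\mathfrak I\to SO(3)$, $\Theta:\mathfrak I\to\mathbb{R}^3$ differentiable, $\sigma(0)=1$, $\Gamma(0)=\mathrm{Id}$,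 $\Theta(0)=0$, such that for some fixed unit vector $e$, $\Gamma(t)$ is the rotation by angle $\xi(t)$ (with $\xi(0)=0$, $\xi$ differentiable) about the axis $\mathbb{R}e$, and $\Theta(t)=\zeta(t)e$. Any of dilation, rotation, translation may be absent. The family $\widehat X^t=L(t)X$ is a self-similar solution to the mean curvature flow if $\langle\partial_t\widehat X^t,N^t\rangle=H^t$ for all $t\in\mathfrak I$ and at all points, where $N^t$ is a unit normal of $\widehat X^t$ and $H^t$ its mean curvature with respect to $N^t$. *)

theory Defs
  imports "HOL-Analysis.Analysis"
begin

(* Ck_on and smooth_on are meant for open S: the derivatives are the unrestricted ones. *)
primrec Ck_on ::
  "nat \<Rightarrow> 'a::real_normed_vector set \<Rightarrow> ('a \<Rightarrow> 'b::real_normed_vector) \<Rightarrow> bool" where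
  "Ck_on 0 S f \<longleftrightarrow> continuous_on S f"
| "Ck_on (Suc k) S f \<longleftrightarrow>
     (\<forall>x\<in>S. f differentiable (at x)) \<and>
     (\<forall>v. Ck_on k S (\<lambda>x. frechet_derivative f (at x) v))"

definition smooth_on ::
  "'a::real_normed_vector set \<Rightarrow> ('a \<Rightarrow> 'b::real_normed_vector) \<Rightarrow> bool" where
  "smooth_on S f \<longleftrightarrow> (\<forall>k. Ck_on k S f)"

definition immersion_on :: "(real \<times> real) set \<Rightarrow> (real \<times> real \<Rightarrow> real^3) \<Rightarrow> bool" where
  "immersion_on U X \<longleftrightarrow>
     smooth_on U X \<and> (\<forall>p\<in>U. inj (frechet_derivative X (at p)))"

definition partial_s :: "(real \<times> real \<Rightarrow> real^3) \<Rightarrow> real \<times> real \<Rightarrow> real^3" where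
  "partial_s X p = vector_derivative (\<lambda>s. X (s, snd p)) (at (fst p))"

definition partial_u :: "(real \<times> real \<Rightarrow> real^3) \<Rightarrow> real \<times> real \<Rightarrow> real^3" where
  "partial_u X p = vector_derivative (\<lambda>u. X (fst p, u)) (at (snd p))"

(* No continuity of N is required: wherever N is used below, the condition at each point
   is invariant under replacing N by -N, which also changes the sign of the mean curvature. *)
definition unit_normal_on ::
  "(real \<times> real) set \<Rightarrow> (real \<times> real \<Rightarrow> real^3) \<Rightarrow> (real \<times> real \<Rightarrow> real^3) \<Rightarrow> bool" where
  "unit_normal_on U X N \<longleftrightarrow>
     (\<forall>p\<in>U. norm (N p) = 1 \<and> orthogonal (N p) (partial_s X p) \<and>
             orthogonal (N p) (partial_u X p))"

definition mean_curvature ::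
  "(real \<times> real \<Rightarrow> real^3) \<Rightarrow> (real \<times> real \<Rightarrow> real^3) \<Rightarrow> real \<times> real \<Rightarrow> real" where
  "mean_curvature X N p =
     (let E = partial_s X p \<bullet> partial_s X p;
          F = partial_s X p \<bullet> partial_u X p;
          G = partial_u X p \<bullet> partial_u X p;
          e = N p \<bullet> partial_s (partial_s X) p;
          f = N p \<bullet> partial_u (partial_s X) p;
          g = N p \<bullet> partial_u (partial_u X) p
      in (E * g - 2 * f * F + G * e) / (2 * (E * G - F\<^sup>2)))"

definition minimal_on :: "(real \<times> real) set \<Rightarrow> (real \<times> real \<Rightarrow> real^3) \<Rightarrow> bool" where
  "minimal_on U X \<longleftrightarrow>
     (\<forall>N. unit_normal_on U X N \<longrightarrow> (\<forall>p\<in>U. mean_curvature X N p = 0))"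

definition ruled_surface ::
  "(real \<Rightarrow> real^3) \<Rightarrow> (real \<Rightarrow> real^3) \<Rightarrow> real \<times> real \<Rightarrow> real^3" where
  "ruled_surface \<beta> w = (\<lambda>(s, u). \<beta> s + u *\<^sub>R w s)"

(* Rodrigues' formula: rotation by the angle phi about the line spanned by the unit vector a *)
definition axis_rotation :: "real^3 \<Rightarrow> real \<Rightarrow> real^3 \<Rightarrow> real^3" where
  "axis_rotation a \<phi> x =
     cos \<phi> *\<^sub>R x + sin \<phi> *\<^sub>R cross3 a x + ((1 - cos \<phi>) * (a \<bullet> x)) *\<^sub>R a"

(* T may contain its endpoints, where differentiability is one-sided; T must be
   nondegenerate for time derivatives to make sense. *)
definition homothetic_helicoidal_motion ::
  "real set \<Rightarrow> (real \<Rightarrow> real) \<Rightarrow> (real \<Rightarrow> real^3^3) \<Rightarrow> (real \<Rightarrow> real^3) \<Rightarrow> bool" where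
  "homothetic_helicoidal_motion T \<sigma> \<Gamma> \<Theta> \<longleftrightarrow>
     is_interval T \<and> 0 \<in> T \<and> T \<noteq> {0} \<and>
     \<sigma> differentiable_on T \<and> \<Gamma> differentiable_on T \<and> \<Theta> differentiable_on T \<and>
     (\<forall>t\<in>T. \<sigma> t > 0 \<and> rotation_matrix (\<Gamma> t)) \<and>
     \<sigma> 0 = 1 \<and> \<Gamma> 0 = mat 1 \<and> \<Theta> 0 = 0 \<and>
     (\<exists>a \<xi> \<zeta>. norm a = 1 \<and> \<xi> differentiable_on T \<and> \<xi> 0 = 0 \<and>
        (\<forall>t\<in>T. (\<forall>x. \<Gamma> t *v x = axis_rotation a (\<xi> t) x) \<and> \<Theta> t = \<zeta> t *\<^sub>R a))"

definition moved_surface ::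
  "(real \<Rightarrow> real) \<Rightarrow> (real \<Rightarrow> real^3^3) \<Rightarrow> (real \<Rightarrow> real^3) \<Rightarrow>
   (real \<times> real \<Rightarrow> real^3) \<Rightarrow> real \<Rightarrow> real \<times> real \<Rightarrow> real^3" where
  "moved_surface \<sigma> \<Gamma> \<Theta> X t p = \<sigma> t *\<^sub>R (\<Gamma> t *v X p) + \<Theta> t"

definition self_similar_mcf ::
  "real set \<Rightarrow> (real \<Rightarrow> real) \<Rightarrow> (real \<Rightarrow> real^3^3) \<Rightarrow> (real \<Rightarrow> real^3) \<Rightarrow>
   (real \<times> real) set \<Rightarrow> (real \<times> real \<Rightarrow> real^3) \<Rightarrow> bool" where
  "self_similar_mcf T \<sigma> \<Gamma> \<Theta> U X \<longleftrightarrow>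
     (\<exists>N. \<forall>t\<in>T. unit_normal_on U (moved_surface \<sigma> \<Gamma> \<Theta> X t) (N t) \<and>
        (\<forall>p\<in>U. vector_derivative (\<lambda>r. moved_surface \<sigma> \<Gamma> \<Theta> X r p) (at t within T) \<bullet> N t p
                = mean_curvature (moved_surface \<sigma> \<Gamma> \<Theta> X t) (N t) p))"

end

theory Submission
  imports Defs
begin

text \<open>
  At \<open>t = 0\<close> the motion has a velocity field \<open>V x = \<alpha> x + b \<times> x + c\<close>, so a self-similar solution
  satisfies \<open>\<langle>V, N\<rangle> = H\<close> on the ruled surface itself. In the orthonormal frame
  \<open>w, w', n = w \<times> w'\<close> along the line of striction, write \<open>\<beta>' = F w + Q n\<close> and \<open>w'' = - w + J n\<close>.
  The normal at \<open>\<beta> s + u w s\<close> is parallel to \<open>Q w' - u n\<close>, and both sides of the equation become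
  explicit rational functions of \<open>u\<close>; clearing denominators gives a quartic polynomial in \<open>u\<close>
  that vanishes along a piece of each ruling (\<open>velocity_equation\<close>). Its five coefficients must
  vanish (\<open>quartic_coefficients\<close>):
  \<open>\<langle>b, w'\<rangle> = 0\<close>, \<open>\<langle>V \<beta>, n\<rangle> = Q \<langle>b, n\<rangle>\<close>, \<open>2 Q \<langle>V \<beta>, w'\<rangle> + J = 0\<close>, \<open>Q' = 0\<close> and \<open>Q F = 0\<close>.

  The numerator of \<open>H\<close> is a multiple of \<open>J (u\<^sup>2 + Q\<^sup>2) + Q F + u Q'\<close> (\<open>mean_curvature_ruled\<close>), so
  once \<open>Q'\<close> and \<open>Q F\<close> vanish, minimality amounts to \<open>J = 0\<close>. This follows by differentiating the coefficient relations along
  the striction line (\<open>J_zero\<close>). Where \<open>J \<noteq> 0\<close>, also \<open>Q \<noteq> 0\<close> and therefore \<open>F = 0\<close>. The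
  derivative of the second relation, combined with the third, shows that \<open>J\<^sup>2 = - 2 \<alpha> Q\<^sup>2\<close>, which is
  locally constant because \<open>Q\<close> is; the derivative of the third then gives \<open>\<langle>V \<beta>, w\<rangle> = 0\<close>, whose
  derivative is \<open>\<langle>V \<beta>, w'\<rangle> = 0\<close>. By the third relation \<open>J = 0\<close> after all. The argument treats dilations, rotations and translations
  at once, without distinguishing which of them are present.
\<close>

section \<open>Orthonormal frames and linear velocity fields in space\<close>

lemma cross3_dot_swap: "cross3 a x \<bullet> y = a \<bullet> cross3 x y"
  by (simp add: cross3_simps)

lemma orthonormal_frame:
  fixes p q :: "real^3"
  assumes "p \<bullet> p = 1" and "q \<bullet> q = 1" and "p \<bullet> q = 0"
  shows orthonormal_frame_cross: "cross3 q (cross3 p q) = p" "cross3 (cross3 p q) p = q"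
    and orthonormal_frame_unit: "cross3 p q \<bullet> cross3 p q = 1"
    and orthonormal_frame_expansion:
      "x = (x \<bullet> p) *\<^sub>R p + (x \<bullet> q) *\<^sub>R q + (x \<bullet> cross3 p q) *\<^sub>R cross3 p q"
proof -
  have lag': "cross3 (cross3 y z) x = (x \<bullet> y) *\<^sub>R z - (x \<bullet> z) *\<^sub>R y" for x y z :: "real^3"
    using Lagrange[of x y z] cross_skew[of "cross3 y z" x] by simp
  show 1: "cross3 q (cross3 p q) = p" "cross3 (cross3 p q) p = q"
    using assms by (simp_all add: Lagrange lag' inner_commute)
  show 2: "cross3 p q \<bullet> cross3 p q = 1"
    using assms 1 by (simp add: cross3_dot_swap)
  define y where "y = x - ((x \<bullet> p) *\<^sub>R p + (x \<bullet> q) *\<^sub>R q + (x \<bullet> cross3 p q) *\<^sub>R cross3 p q)"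
  have yp: "y \<bullet> p = 0" and yq: "y \<bullet> q = 0" and yr: "cross3 p q \<bullet> y = 0"
    using assms 2 unfolding y_def
    by (simp_all add: inner_diff_left inner_add_left inner_diff_right inner_add_right
        inner_commute dot_cross_self)
  have "cross3 (cross3 p q) y = 0"
    using yp yq by (simp add: lag')
  with yr have "y = 0"
    using norm_and_cross_eq_0[of "cross3 p q" y] 2 by auto
  then show "x = (x \<bullet> p) *\<^sub>R p + (x \<bullet> q) *\<^sub>R q + (x \<bullet> cross3 p q) *\<^sub>R cross3 p q"
    by (simp add: y_def)
qed

lemma has_real_derivative_inner:
  fixes f g :: "real \<Rightarrow> 'a::real_inner"
  assumes "(f has_vector_derivative f') (at s)" and "(g has_vector_derivative g') (at s)"
  shows "((\<lambda>s. f s \<bullet> g s) has_real_derivative f s \<bullet> g' + f' \<bullet> g s) (at s)"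
  using bounded_bilinear.has_vector_derivative[OF bounded_bilinear_inner assms]
  by (simp add: has_real_derivative_iff_has_vector_derivative)

lemma bounded_bilinear_cross3: "bounded_bilinear cross3"
  using bilinear_cross bilinear_conv_bounded_bilinear by blast

lemma derivative_of_locally_constant:
  assumes "(f has_real_derivative d) (at s)" and "open S" and "s \<in> S"
    and "\<And>r. r \<in> S \<Longrightarrow> f r = c"
  shows "d = 0"
  using has_field_derivative_transform_within_open[OF assms] DERIV_const DERIV_unique by blast

definition linear_velocity :: "real \<Rightarrow> real^3 \<Rightarrow> real^3 \<Rightarrow> real^3 \<Rightarrow> real^3" where
  "linear_velocity \<alpha> b c x = \<alpha> *\<^sub>R x + cross3 b x + c"

section \<open>Curves carrying a striction frame\<close>

text \<open>
  The derivatives are parameters: \<open>\<beta>1\<close>, \<open>\<beta>2\<close> and \<open>w1\<close>, \<open>w2\<close>, \<open>w3\<close> are the successive derivatives of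
  the line of striction \<open>\<beta>\<close> and of the ruling direction \<open>w\<close>. The third derivative of \<open>w\<close> makes
  \<open>J\<close> below differentiable.
\<close>

locale striction_frame =
  fixes S :: "real set" and \<beta> \<beta>1 \<beta>2 w w1 w2 w3 :: "real \<Rightarrow> real^3"
  assumes open_S: "open S"
    and \<beta>_deriv: "s \<in> S \<Longrightarrow> (\<beta> has_vector_derivative \<beta>1 s) (at s)"
    and \<beta>1_deriv: "s \<in> S \<Longrightarrow> (\<beta>1 has_vector_derivative \<beta>2 s) (at s)"
    and w_deriv: "s \<in> S \<Longrightarrow> (w has_vector_derivative w1 s) (at s)"
    and w1_deriv: "s \<in> S \<Longrightarrow> (w1 has_vector_derivative w2 s) (at s)"
    and w2_deriv: "s \<in> S \<Longrightarrow> (w2 has_vector_derivative w3 s) (at s)"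
    and w_unit: "s \<in> S \<Longrightarrow> w s \<bullet> w s = 1"
    and w1_unit: "s \<in> S \<Longrightarrow> w1 s \<bullet> w1 s = 1"
    and striction: "s \<in> S \<Longrightarrow> \<beta>1 s \<bullet> w1 s = 0"
begin

text \<open>
  The functions \<open>F\<close>, \<open>Q\<close> and \<open>J\<close> are the classical invariants of a ruled surface; \<open>Q\<close> is its
  distribution parameter, and \<open>J\<close> is the geodesic curvature of the spherical curve \<open>w\<close>.
  The formula for \<open>Q'\<close> is the derivative of \<open>Q\<close> because \<open>n'\<close> is parallel to \<open>w'\<close> and hence
  orthogonal to \<open>\<beta>'\<close>.
\<close>

definition n :: "real \<Rightarrow> real^3" where "n s = cross3 (w s) (w1 s)"
definition F :: "real \<Rightarrow> real" where "F s = \<beta>1 s \<bullet> w s"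
definition Q :: "real \<Rightarrow> real" where "Q s = \<beta>1 s \<bullet> n s"
definition Q' :: "real \<Rightarrow> real" where "Q' s = \<beta>2 s \<bullet> n s"
definition J :: "real \<Rightarrow> real" where "J s = w2 s \<bullet> n s"

lemma w_w1: "w s \<bullet> w1 s = 0" if "s \<in> S"
  using derivative_of_locally_constant[OF has_real_derivative_inner[OF w_deriv w_deriv] open_S]
    that w_unit by (fastforce simp: inner_commute)

lemma frame_cross: "cross3 (w1 s) (n s) = w s" "cross3 (n s) (w s) = w1 s" if "s \<in> S"
  unfolding n_def using that by (simp_all add: orthonormal_frame_cross w_unit w1_unit w_w1)

lemma frame_expansion:
  "x = (x \<bullet> w s) *\<^sub>R w s + (x \<bullet> w1 s) *\<^sub>R w1 s + (x \<bullet> n s) *\<^sub>R n s" if "s \<in> S"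
  unfolding n_def using that by (intro orthonormal_frame_expansion w_unit w1_unit w_w1)

lemma n_orth: "w s \<bullet> n s = 0" "w1 s \<bullet> n s = 0" "n s \<bullet> w s = 0" "n s \<bullet> w1 s = 0"
  by (simp_all add: n_def dot_cross_self inner_commute)

lemma frame_products: "w s \<bullet> w s = 1" "w1 s \<bullet> w1 s = 1" "n s \<bullet> n s = 1"
  "w s \<bullet> w1 s = 0" "w1 s \<bullet> w s = 0" if "s \<in> S"
  unfolding n_def using that w_w1[OF that]
  by (simp_all add: w_unit w1_unit orthonormal_frame_unit inner_commute)

lemma w2_expansion: "w2 s = - w s + J s *\<^sub>R n s" if s: "s \<in> S"
proof -
  have "w1 s \<bullet> w2 s = 0"
    using derivative_of_locally_constant[OF has_real_derivative_inner[OF w1_deriv w1_deriv] open_S]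
      s w1_unit by (fastforce simp: inner_commute)
  moreover have "w s \<bullet> w2 s + w1 s \<bullet> w1 s = 0"
    using derivative_of_locally_constant[OF has_real_derivative_inner[OF w_deriv w1_deriv] open_S]
      s w_w1 by blast
  ultimately show ?thesis
    using frame_expansion[OF s, of "w2 s"] w1_unit[OF s] by (simp add: J_def inner_commute add_eq_0_iff)
qed

lemma n_deriv: "(n has_vector_derivative - J s *\<^sub>R w1 s) (at s)" if s: "s \<in> S"
proof -
  have "cross3 (w s) (w2 s) + cross3 (w1 s) (w1 s) = - J s *\<^sub>R w1 s"
    using w2_expansion[OF s] frame_cross[OF s] cross_skew[of "w s" "n s"]
    by (simp add: Cross3.right_diff_distrib cross_mult_right)
  then show ?thesis
    using bounded_bilinear.has_vector_derivative[OF bounded_bilinear_cross3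
        w_deriv[OF s] w1_deriv[OF s]]
    unfolding n_def[abs_def] by simp
qed

lemma \<beta>1_expansion: "\<beta>1 s = F s *\<^sub>R w s + Q s *\<^sub>R n s" if "s \<in> S"
  using frame_expansion[OF that, of "\<beta>1 s"] striction[OF that] by (simp add: F_def Q_def)

lemma \<beta>2_w1: "\<beta>2 s \<bullet> w1 s = F s - J s * Q s" if s: "s \<in> S"
proof -
  have "\<beta>1 s \<bullet> w2 s + \<beta>2 s \<bullet> w1 s = 0"
    using derivative_of_locally_constant[OF has_real_derivative_inner[OF \<beta>1_deriv w1_deriv] open_S]
      s striction by blast
  then show ?thesis
    using w2_expansion[OF s] by (simp add: inner_diff_right F_def Q_def)
qed

lemma Q_deriv: "(Q has_real_derivative Q' s) (at s)" if s: "s \<in> S"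
  using has_real_derivative_inner[OF \<beta>1_deriv[OF s] n_deriv[OF s]] striction[OF s]
  unfolding Q_def[abs_def] Q'_def by simp

lemma J_deriv: "\<exists>d. (J has_real_derivative d) (at s)" if s: "s \<in> S"
  using has_real_derivative_inner[OF w2_deriv[OF s] n_deriv[OF s]]
  unfolding J_def[abs_def] by blast

section \<open>Rigidity of striction frames\<close>

text \<open>
  The hypotheses are the five coefficient relations. If \<open>J\<close> were nonzero somewhere, then it would be
  nonzero on an open set \<open>W\<close>. There \<open>Q\<close> and \<open>J\<close> are locally constant and \<open>F\<close> vanishes, so that
  differentiating the relations yields only a few terms.
\<close>

lemma J_zero:
  assumes s: "s \<in> S"
    and b2: "\<And>s. s \<in> S \<Longrightarrow> b \<bullet> w1 s = 0"
    and B: "\<And>s. s \<in> S \<Longrightarrow> linear_velocity \<alpha> b c (\<beta> s) \<bullet> n s = Q s * (b \<bullet> n s)"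
    and A: "\<And>s. s \<in> S \<Longrightarrow> 2 * Q s * (linear_velocity \<alpha> b c (\<beta> s) \<bullet> w1 s) + J s = 0"
    and Q': "\<And>s. s \<in> S \<Longrightarrow> Q' s = 0"
    and QF: "\<And>s. s \<in> S \<Longrightarrow> Q s * F s = 0"
  shows "J s = 0"
proof (rule ccontr)
  assume Js: "J s \<noteq> 0"
  define W where "W = {s\<in>S. J s \<noteq> 0}"
  have WS: "r \<in> S" if "r \<in> W" for r using that by (simp add: W_def)
  have sW: "s \<in> W" using s Js by (simp add: W_def)
  have "continuous_on S J"
    using J_deriv by (meson DERIV_isCont continuous_at_imp_continuous_on)
  then have openW: "open W"
    using open_S continuous_open_preimage[of S J "- {0}"] open_Compl[OF closed_singleton[of "0::real"]]
    by (simp add: W_def vimage_def Int_def)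
  define V where "V s = linear_velocity \<alpha> b c (\<beta> s)" for s
  define V' where "V' s = \<alpha> *\<^sub>R \<beta>1 s + cross3 b (\<beta>1 s)" for s
  have V_deriv: "(V has_vector_derivative V' r) (at r)" if "r \<in> S" for r
    using bounded_bilinear.has_vector_derivative[OF bounded_bilinear_cross3
        has_vector_derivative_const[of b] \<beta>_deriv[OF that]]
    unfolding V_def[abs_def] V'_def linear_velocity_def
    by (auto intro!: derivative_eq_intros \<beta>_deriv[OF that])
  have Q0: "Q r \<noteq> 0" if "r \<in> W" for r
    using A[of r] that by (auto simp: W_def)
  have F0: "F r = 0" if "r \<in> W" for r
    using QF[OF WS[OF that]] Q0[OF that] by simp
  have V'1: "V' r \<bullet> w r = 0" and V'2: "V' r \<bullet> w1 r = - (Q r * (b \<bullet> w r))"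
    and V'3: "V' r \<bullet> n r = \<alpha> * Q r" if r: "r \<in> W" for r
  proof -
    note rS = WS[OF r]
    have "cross3 (n r) (w1 r) = - w r"
      using frame_cross(1)[OF rS] cross_skew[of "n r" "w1 r"] by simp
    then show "V' r \<bullet> w r = 0" "V' r \<bullet> w1 r = - (Q r * (b \<bullet> w r))" "V' r \<bullet> n r = \<alpha> * Q r"
      using \<beta>1_expansion[OF rS] F0[OF r] frame_cross(2)[OF rS] b2[OF rS] frame_products[OF rS]
      by (simp_all add: V'_def inner_add_left cross_mult_right cross3_dot_swap n_orth)
  qed
  \<comment> \<open>the derivative of \<open>\<langle>b, w'\<rangle> = 0\<close>\<close>
  have b1: "b \<bullet> w r = J r * (b \<bullet> n r)" if r: "r \<in> W" for r
  proof -
    have "b \<bullet> w2 r + 0 \<bullet> w1 r = 0"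
      using derivative_of_locally_constant[OF has_real_derivative_inner[OF
            has_vector_derivative_const w1_deriv[OF WS[OF r]]] open_S WS[OF r]] b2 by blast
    then show ?thesis
      using w2_expansion[OF WS[OF r]] by (simp add: inner_diff_right)
  qed
  \<comment> \<open>the derivative of \<open>\<langle>V \<beta>, n\<rangle> = Q \<langle>b, n\<rangle>\<close>; the rotation drops out
      because \<open>b \<times> n\<close> is orthogonal to \<open>n\<close> and \<open>n'\<close>, being parallel to \<open>w'\<close>, is orthogonal to \<open>b\<close>\<close>
  have scale: "J r * (V r \<bullet> w1 r) = \<alpha> * Q r" if r: "r \<in> W" for r
  proof -
    note rS = WS[OF r]
    have "((\<lambda>s. V s \<bullet> n s - Q s * (b \<bullet> n s)) has_real_derivative
        (V r \<bullet> (- J r *\<^sub>R w1 r) + V' r \<bullet> n r)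
          - (Q' r * (b \<bullet> n r) + (b \<bullet> (- J r *\<^sub>R w1 r) + 0 \<bullet> n r) * Q r)) (at r)"
      by (intro DERIV_diff DERIV_mult has_real_derivative_inner V_deriv n_deriv Q_deriv rS
          has_vector_derivative_const)
    from derivative_of_locally_constant[OF this open_S rS, of 0] show ?thesis
      using B Q'[OF rS] b2[OF rS] V'3[OF r] by (simp add: V_def)
  qed
  have Jsq: "J r * J r + 2 * \<alpha> * (Q r * Q r) = 0" if r: "r \<in> W" for r
  proof -
    have "J r * (2 * Q r * (V r \<bullet> w1 r) + J r) = 0"
      using A[OF WS[OF r]] by (simp add: V_def)
    then show ?thesis
      using scale[OF r] by algebra
  qed
  \<comment> \<open>\<open>J\<^sup>2\<close> is locally constant since \<open>Q\<close> is, and \<open>J\<close> is nonzero here\<close>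
  have J': "(J has_real_derivative 0) (at r)" if r: "r \<in> W" for r
  proof -
    obtain d where d: "(J has_real_derivative d) (at r)"
      using J_deriv WS[OF r] by blast
    have "((\<lambda>s. J s * J s + 2 * \<alpha> * (Q s * Q s)) has_real_derivative 2 * J r * d) (at r)"
      using Q'[OF WS[OF r]] by (auto intro!: derivative_eq_intros d Q_deriv WS[OF r])
    from derivative_of_locally_constant[OF this openW r Jsq] show ?thesis
      using d r by (simp add: W_def)
  qed
  \<comment> \<open>Differentiating \<open>2 Q \<langle>V \<beta>, w'\<rangle> + J = 0\<close>, with \<open>Q\<close> and \<open>J\<close> locally constant, leaves
      \<open>- \<langle>V \<beta>, w\<rangle> + J \<langle>V \<beta>, n\<rangle> - Q \<langle>b, w\<rangle> = 0\<close>, and the last two terms cancel.\<close>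
  have V1: "V r \<bullet> w r = 0" if r: "r \<in> W" for r
  proof -
    note rS = WS[OF r]
    have "((\<lambda>s. 2 * Q s * (V s \<bullet> w1 s) + J s) has_real_derivative
        2 * Q r * (V r \<bullet> w2 r + V' r \<bullet> w1 r)) (at r)"
      using Q'[OF rS]
      by (auto intro!: derivative_eq_intros J' r Q_deriv rS has_real_derivative_inner[OF
            V_deriv[OF rS] w1_deriv[OF rS]])
    from derivative_of_locally_constant[OF this open_S rS, of 0]
    have "V r \<bullet> w2 r + V' r \<bullet> w1 r = 0"
      using A Q0[OF r] by (simp add: V_def)
    then show ?thesis
      using w2_expansion[OF rS] V'2[OF r] B[OF rS] b1[OF r]
      by (simp add: inner_diff_right V_def)
  qed
  have "V s \<bullet> w1 s + V' s \<bullet> w s = 0"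
    using derivative_of_locally_constant[OF has_real_derivative_inner[OF V_deriv w_deriv] openW sW]
      V1 s by blast
  then have "V s \<bullet> w1 s = 0"
    using V'1[OF sW] by simp
  then show False
    using A[OF s] Js by (simp add: V_def)
qed

section \<open>Geometry of the ruled surface\<close>

lemma partial_s_ruled:
  assumes "fst p \<in> S"
  shows "partial_s (ruled_surface \<beta> w) p = \<beta>1 (fst p) + snd p *\<^sub>R w1 (fst p)"
  unfolding partial_s_def ruled_surface_def
  by (rule vector_derivative_at) (auto intro!: derivative_eq_intros \<beta>_deriv w_deriv assms)

lemma partial_u_ruled: "partial_u (ruled_surface \<beta> w) p = w (fst p)"
  unfolding partial_u_def ruled_surface_def
  by (rule vector_derivative_at) (auto intro!: derivative_eq_intros)

lemma partial_ss_ruled: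
  assumes "fst p \<in> S"
  shows "partial_s (partial_s (ruled_surface \<beta> w)) p = \<beta>2 (fst p) + snd p *\<^sub>R w2 (fst p)"
proof -
  have "((\<lambda>s. \<beta>1 s + snd p *\<^sub>R w1 s) has_vector_derivative \<beta>2 (fst p) + snd p *\<^sub>R w2 (fst p))
      (at (fst p))"
    by (auto intro!: derivative_eq_intros \<beta>1_deriv w1_deriv assms)
  then have "((\<lambda>s. partial_s (ruled_surface \<beta> w) (s, snd p)) has_vector_derivative
      \<beta>2 (fst p) + snd p *\<^sub>R w2 (fst p)) (at (fst p))"
    by (rule has_vector_derivative_transform_within_open[OF _ open_S assms])
      (simp add: partial_s_ruled)
  then show ?thesis
    unfolding partial_s_def[of "partial_s _"] by (rule vector_derivative_at)
qed

lemma partial_us_ruled: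
  assumes "fst p \<in> S"
  shows "partial_u (partial_s (ruled_surface \<beta> w)) p = w1 (fst p)"
  unfolding partial_u_def using assms
  by (auto simp: partial_s_ruled intro!: vector_derivative_at derivative_eq_intros)

lemma partial_uu_ruled: "partial_u (partial_u (ruled_surface \<beta> w)) p = 0"
  unfolding partial_u_def[of "partial_u _"] by (simp add: partial_u_ruled)

text \<open>
  Unit normals are determined only up to a sign that may vary from point to point. The factor \<open>\<mu>\<close>
  absorbs this sign along with the normalization; being nonzero, it cancels from \<open>\<langle>V, N\<rangle> = H\<close>.
\<close>

lemma unit_normal_ruled:
  assumes N: "unit_normal_on U (ruled_surface \<beta> w) N" and p: "(s, u) \<in> U" and s: "s \<in> S"
    and D: "u\<^sup>2 + (Q s)\<^sup>2 \<noteq> 0"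
  obtains \<mu> where "\<mu> \<noteq> 0" and "N (s, u) = \<mu> *\<^sub>R (Q s *\<^sub>R w1 s - u *\<^sub>R n s)"
proof -
  let ?N = "N (s, u)"
  have unit: "norm ?N = 1" and Nw: "?N \<bullet> w s = 0"
    and Ns: "?N \<bullet> (\<beta>1 s + u *\<^sub>R w1 s) = 0"
    using N p s by (auto simp: unit_normal_on_def orthogonal_def partial_s_ruled partial_u_ruled)
  define x y where "x = ?N \<bullet> w1 s" and "y = ?N \<bullet> n s"
  have ex: "?N = x *\<^sub>R w1 s + y *\<^sub>R n s"
    using frame_expansion[OF s, of ?N] Nw by (simp add: x_def y_def)
  have xy: "u * x + Q s * y = 0"
    using Ns \<beta>1_expansion[OF s] Nw by (simp add: inner_add_right x_def y_def)
  \<comment> \<open>\<open>(x, y)\<close> is orthogonal to \<open>(u, Q)\<close>, so \<open>\<mu>\<close> is its coordinate along \<open>(Q, - u)\<close>\<close>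
  define \<mu> where "\<mu> = (Q s * x - u * y) / (u\<^sup>2 + (Q s)\<^sup>2)"
  have "x * (u\<^sup>2 + (Q s)\<^sup>2) = Q s * (Q s * x - u * y) + u * (u * x + Q s * y)"
    by (simp add: algebra_simps power2_eq_square)
  then have "x * (u\<^sup>2 + (Q s)\<^sup>2) = Q s * (Q s * x - u * y)"
    unfolding xy by simp
  then have x: "x = \<mu> * Q s"
    using D unfolding \<mu>_def times_divide_eq_left by (subst eq_divide_eq) (simp add: mult.commute)
  have "y * (u\<^sup>2 + (Q s)\<^sup>2) = - u * (Q s * x - u * y) + Q s * (u * x + Q s * y)"
    by (simp add: algebra_simps power2_eq_square)
  then have "- y * (u\<^sup>2 + (Q s)\<^sup>2) = u * (Q s * x - u * y)"
    unfolding xy by simp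
  then have "- y = \<mu> * u"
    using D unfolding \<mu>_def times_divide_eq_left by (subst eq_divide_eq) (simp add: mult.commute)
  then have y: "y = - (\<mu> * u)"
    by simp
  have N': "?N = \<mu> *\<^sub>R (Q s *\<^sub>R w1 s - u *\<^sub>R n s)"
    using ex by (simp add: x y algebra_simps)
  moreover have "\<mu> \<noteq> 0"
    using unit N' by auto
  ultimately show ?thesis
    using that by blast
qed

lemma mean_curvature_ruled:
  assumes N: "N (s, u) = \<mu> *\<^sub>R (Q s *\<^sub>R w1 s - u *\<^sub>R n s)" and s: "s \<in> S"
  shows "mean_curvature (ruled_surface \<beta> w) N (s, u)
    = - \<mu> * (J s * (u\<^sup>2 + (Q s)\<^sup>2) + Q s * F s + u * Q' s) / (2 * (u\<^sup>2 + (Q s)\<^sup>2))"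
proof -
  note fp = frame_products[OF s]
  let ?Xs = "\<beta>1 s + u *\<^sub>R w1 s" and ?N = "\<mu> *\<^sub>R (Q s *\<^sub>R w1 s - u *\<^sub>R n s)"
  have E: "?Xs \<bullet> ?Xs = (F s)\<^sup>2 + (Q s)\<^sup>2 + u\<^sup>2" and F: "?Xs \<bullet> w s = F s"
    using fp n_orth by (simp_all add: \<beta>1_expansion[OF s] inner_add_left inner_add_right
        power2_eq_square inner_commute)
  have f: "?N \<bullet> w1 s = \<mu> * Q s"
    using fp n_orth by (simp add: inner_diff_left)
  have "w1 s \<bullet> \<beta>2 s = F s - J s * Q s" "n s \<bullet> \<beta>2 s = Q' s"
    using \<beta>2_w1[OF s] by (simp_all add: Q'_def inner_commute)
  moreover have "w1 s \<bullet> w2 s = 0" "n s \<bullet> w2 s = J s"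
    using fp n_orth by (simp_all add: w2_expansion[OF s] inner_diff_right)
  ultimately have "?N \<bullet> (\<beta>2 s + u *\<^sub>R w2 s) = \<mu> * (Q s * (F s - J s * Q s) - u * (Q' s + u * J s))"
    by (simp add: inner_diff_left inner_add_right) (simp add: algebra_simps)
  then have e: "?N \<bullet> (\<beta>2 s + u *\<^sub>R w2 s)
      = \<mu> * (Q s * F s - J s * (u\<^sup>2 + (Q s)\<^sup>2) - u * Q' s)"
    by (simp add: algebra_simps power2_eq_square)
  have "mean_curvature (ruled_surface \<beta> w) N (s, u)
      = (\<mu> * (Q s * F s - J s * (u\<^sup>2 + (Q s)\<^sup>2) - u * Q' s) - 2 * (\<mu> * Q s) * F s)
        / (2 * ((F s)\<^sup>2 + (Q s)\<^sup>2 + u\<^sup>2 - (F s)\<^sup>2))"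
    using s by (simp only: mean_curvature_def Let_def N partial_s_ruled partial_u_ruled
        partial_ss_ruled partial_us_ruled partial_uu_ruled fst_conv snd_conv E F f e w_unit)
      simp
  also have "\<dots> = - \<mu> * (J s * (u\<^sup>2 + (Q s)\<^sup>2) + Q s * F s + u * Q' s) / (2 * (u\<^sup>2 + (Q s)\<^sup>2))"
    by (simp add: algebra_simps)
  finally show ?thesis .
qed

text \<open>
  Since \<open>V\<close> is affine, \<open>\<langle>V, N\<rangle>\<close> is \<open>\<mu>\<close> times a quadratic polynomial in \<open>u\<close>. The dilation contributes
  only through \<open>V \<beta>\<close>, because \<open>w\<close> is orthogonal to the normal. Multiplying by the denominator of
  the mean curvature yields the quartic.
\<close>

lemma velocity_equation:
  assumes N: "N (s, u) = \<mu> *\<^sub>R (Q s *\<^sub>R w1 s - u *\<^sub>R n s)" and \<mu>: "\<mu> \<noteq> 0" and s: "s \<in> S"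
    and D: "u\<^sup>2 + (Q s)\<^sup>2 \<noteq> 0"
    and eq: "linear_velocity \<alpha> b c (ruled_surface \<beta> w (s, u)) \<bullet> N (s, u)
      = mean_curvature (ruled_surface \<beta> w) N (s, u)"
  defines "A \<equiv> linear_velocity \<alpha> b c (\<beta> s) \<bullet> w1 s" and "B \<equiv> linear_velocity \<alpha> b c (\<beta> s) \<bullet> n s"
  shows "(u\<^sup>2 + (Q s)\<^sup>2) * (2 * (Q s * A + u * (Q s * (b \<bullet> n s) - B) + u\<^sup>2 * (b \<bullet> w1 s)) + J s)
      + Q s * F s + u * Q' s = 0"
proof -
  have V: "linear_velocity \<alpha> b c (ruled_surface \<beta> w (s, u))
      = linear_velocity \<alpha> b c (\<beta> s) + u *\<^sub>R (\<alpha> *\<^sub>R w s + cross3 b (w s))"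
    by (simp add: linear_velocity_def ruled_surface_def algebra_simps cross_add_right cross_mult_right)
  have "cross3 (w s) (n s) = - w1 s"
    using frame_cross(2)[OF s] cross_skew[of "w s" "n s"] by simp
  then have V2: "(\<alpha> *\<^sub>R w s + cross3 b (w s)) \<bullet> w1 s = b \<bullet> n s"
    and V3: "(\<alpha> *\<^sub>R w s + cross3 b (w s)) \<bullet> n s = - (b \<bullet> w1 s)"
    using frame_products[OF s] n_orth[of s] by (simp_all add: inner_add_left cross3_dot_swap flip: n_def)
  have "linear_velocity \<alpha> b c (ruled_surface \<beta> w (s, u)) \<bullet> N (s, u)
      = \<mu> * (Q s * A + u * (Q s * (b \<bullet> n s) - B) + u\<^sup>2 * (b \<bullet> w1 s))"
    unfolding N V A_def B_def inner_add_left inner_scaleR_left inner_scaleR_right inner_diff_right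
    using V2 V3 by (simp only: inner_add_left inner_scaleR_left)
      (simp add: algebra_simps power2_eq_square)
  then have "\<mu> * (Q s * A + u * (Q s * (b \<bullet> n s) - B) + u\<^sup>2 * (b \<bullet> w1 s))
      = - \<mu> * (J s * (u\<^sup>2 + (Q s)\<^sup>2) + Q s * F s + u * Q' s) / (2 * (u\<^sup>2 + (Q s)\<^sup>2))"
    using eq mean_curvature_ruled[where N = N, OF N s] by simp
  then have "\<mu> * ((u\<^sup>2 + (Q s)\<^sup>2) * (2 * (Q s * A + u * (Q s * (b \<bullet> n s) - B) + u\<^sup>2 * (b \<bullet> w1 s)) + J s)
      + Q s * F s + u * Q' s) = 0"
    using D by (simp add: field_simps)
  then show ?thesis
    using \<mu> by simp
qed

end

section \<open>Comparing coefficients along a ruling\<close>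

lemma quartic_coefficients:
  fixes A B C D J q k m :: real
  assumes inf: "infinite I"
    and eq: "\<And>u. u \<in> I \<Longrightarrow> (u\<^sup>2 + q\<^sup>2) * (2 * (q * A + u * (q * C - B) + u\<^sup>2 * D) + J) + k + u * m = 0"
  shows "D = 0" and "B = q * C" and "2 * q * A + J = 0" and "m = 0" and "k = 0"
proof -
  define P where "P = [: q\<^sup>2 * (2 * q * A + J) + k, 2 * q\<^sup>2 * (q * C - B) + m,
    2 * q * A + J + 2 * q\<^sup>2 * D, 2 * (q * C - B), 2 * D :]"
  have "poly P u = 0" if "u \<in> I" for u
    using eq[OF that] by (simp add: P_def algebra_simps power2_eq_square)
  then have "I \<subseteq> {u. poly P u = 0}" by blast
  then have "P = 0"
    using inf poly_roots_finite[of P] finite_subset by blast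
  then show "D = 0" and "B = q * C" and "2 * q * A + J = 0" and "m = 0" and "k = 0"
    by (auto simp: P_def)
qed

section \<open>Initial data of the self-similar motion\<close>

lemma has_derivative_real_imp_has_vector_derivative:
  fixes f :: "real \<Rightarrow> 'a::real_normed_vector"
  assumes "(f has_derivative f') (at s)"
  shows "(f has_vector_derivative f' 1) (at s)"
proof -
  have "f' h = h *\<^sub>R f' 1" for h
    using linear_cmul[OF has_derivative_linear[OF assms], of h 1] by simp
  then have "f' = (\<lambda>h. h *\<^sub>R f' 1)"
    by (rule ext)
  then show ?thesis
    using assms unfolding has_vector_derivative_def by metis
qed

lemma smooth_on_vector_derivative:
  fixes f :: "real \<Rightarrow> 'a::real_normed_vector"
  assumes "smooth_on S f"
  shows "smooth_on S (\<lambda>x. frechet_derivative f (at x) 1)"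
    and "s \<in> S \<Longrightarrow> (f has_vector_derivative frechet_derivative f (at s) 1) (at s)"
proof -
  have C: "Ck_on (Suc k) S f" for k
    using assms unfolding smooth_on_def by blast
  then show "smooth_on S (\<lambda>x. frechet_derivative f (at x) 1)"
    by (simp add: smooth_on_def)
  show "(f has_vector_derivative frechet_derivative f (at s) 1) (at s)" if "s \<in> S"
    using C[of 0] that
    by (intro has_derivative_real_imp_has_vector_derivative) (simp flip: frechet_derivative_works)
qed

text \<open>
  Differentiating Rodrigues' formula at angle zero turns the rotation into a cross product:
  \<open>\<alpha> = \<sigma>' 0\<close> is the rate of dilation, \<open>b\<close> the angular velocity \<open>\<xi>' 0\<close> times the axis, and \<open>c = \<Theta>' 0\<close>.
\<close>

lemma homothetic_helicoidal_velocity: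
  assumes "homothetic_helicoidal_motion T \<sigma> \<Gamma> \<Theta>"
  obtains \<alpha> b c where "\<And>X p. vector_derivative (\<lambda>t. moved_surface \<sigma> \<Gamma> \<Theta> X t p) (at 0 within T)
    = linear_velocity \<alpha> b c (X p)"
proof -
  note H = assms[unfolded homothetic_helicoidal_motion_def]
  from H have "\<exists>a \<xi>. \<xi> differentiable_on T \<and> \<xi> 0 = 0 \<and>
      (\<forall>t\<in>T. \<forall>x. \<Gamma> t *v x = axis_rotation a (\<xi> t) x)"
    by blast
  then obtain a \<xi> where \<xi>: "\<xi> differentiable_on T" "\<xi> 0 = 0"
    and rot: "\<And>t x. t \<in> T \<Longrightarrow> \<Gamma> t *v x = axis_rotation a (\<xi> t) x"
    by blast
  have T: "is_interval T" "0 \<in> T" "T \<noteq> {0}"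
    using H by auto
  \<comment> \<open>One-sided time derivatives are unique only because \<open>T\<close> does not degenerate to a point.\<close>
  have "0 islimpt T"
    using connected_imp_perfect[of T 0] T is_interval_connected by force
  then have nontriv: "at 0 within T \<noteq> bot"
    by (simp add: trivial_limit_within)
  obtain \<alpha> where \<alpha>: "(\<sigma> has_vector_derivative \<alpha>) (at 0 within T)"
    using H unfolding differentiable_on_def by (metis vector_derivative_works)
  obtain c where c: "(\<Theta> has_vector_derivative c) (at 0 within T)"
    using H unfolding differentiable_on_def by (metis vector_derivative_works)
  obtain \<omega> where \<omega>: "(\<xi> has_real_derivative \<omega>) (at 0 within T)"
    using \<xi>(1) T(2) unfolding differentiable_on_def
    by (metis vector_derivative_works has_real_derivative_iff_has_vector_derivative)
  have "vector_derivative (\<lambda>t. moved_surface \<sigma> \<Gamma> \<Theta> X t p) (at 0 within T)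
      = linear_velocity \<alpha> (\<omega> *\<^sub>R a) c (X p)" for X :: "real \<times> real \<Rightarrow> real^3" and p
  proof -
    let ?x = "X p"
    have "((\<lambda>t. cos (\<xi> t)) has_vector_derivative 0) (at 0 within T)"
      unfolding has_real_derivative_iff_has_vector_derivative[symmetric]
      by (auto intro!: derivative_eq_intros \<omega> simp: \<xi>)
    moreover have "((\<lambda>t. sin (\<xi> t)) has_vector_derivative \<omega>) (at 0 within T)"
      unfolding has_real_derivative_iff_has_vector_derivative[symmetric]
      by (auto intro!: derivative_eq_intros \<omega> simp: \<xi>)
    moreover have "((\<lambda>t. (1 - cos (\<xi> t)) * (a \<bullet> ?x)) has_vector_derivative 0) (at 0 within T)"
      unfolding has_real_derivative_iff_has_vector_derivative[symmetric]
      by (auto intro!: derivative_eq_intros \<omega> simp: \<xi>)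
    ultimately have "((\<lambda>t. axis_rotation a (\<xi> t) ?x) has_vector_derivative 0 *\<^sub>R ?x
        + \<omega> *\<^sub>R cross3 a ?x + 0 *\<^sub>R a) (at 0 within T)"
      unfolding axis_rotation_def
      by (intro has_vector_derivative_add
          bounded_linear.has_vector_derivative[OF bounded_linear_scaleR_left])
    then have R: "((\<lambda>t. axis_rotation a (\<xi> t) ?x) has_vector_derivative \<omega> *\<^sub>R cross3 a ?x)
        (at 0 within T)"
      by simp
    have "axis_rotation a (\<xi> 0) ?x = ?x"
      by (simp add: axis_rotation_def \<xi>)
    moreover have "\<sigma> 0 = 1" using H by simp
    ultimately have "((\<lambda>t. \<sigma> t *\<^sub>R axis_rotation a (\<xi> t) ?x + \<Theta> t) has_vector_derivative
        linear_velocity \<alpha> (\<omega> *\<^sub>R a) c ?x) (at 0 within T)"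
      using has_vector_derivative_add[OF bounded_bilinear.has_vector_derivative[OF
            bounded_bilinear_scaleR \<alpha> R] c]
      by (simp add: linear_velocity_def cross_mult_left add.commute)
    then have "((\<lambda>t. moved_surface \<sigma> \<Gamma> \<Theta> X t p) has_vector_derivative
        linear_velocity \<alpha> (\<omega> *\<^sub>R a) c ?x) (at 0 within T)"
      by (rule has_vector_derivative_transform[OF T(2), rotated])
        (simp add: moved_surface_def rot)
    then show ?thesis
      by (rule vector_derivative_within[OF nontriv])
  qed
  then show ?thesis
    using that by blast
qed

lemma moved_surface_initial:
  assumes "homothetic_helicoidal_motion T \<sigma> \<Gamma> \<Theta>"
  shows "moved_surface \<sigma> \<Gamma> \<Theta> X 0 = X"
  using assms by (auto simp: homothetic_helicoidal_motion_def moved_surface_def)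

lemma immersion_partials_independent:
  assumes "immersion_on U X" and "p \<in> U"
  shows "partial_s X p \<noteq> k *\<^sub>R partial_u X p"
proof
  assume eq: "partial_s X p = k *\<^sub>R partial_u X p"
  obtain s u where p: "p = (s, u)" by (cases p)
  let ?D = "frechet_derivative X (at p)"
  have "Ck_on (Suc 0) U X" and inj: "inj ?D"
    using assms unfolding immersion_on_def smooth_on_def by blast+
  then have D: "(X has_derivative ?D) (at (s, u))"
    using assms(2) by (simp add: frechet_derivative_works p)
  have "((\<lambda>r. X (r, u)) has_derivative (\<lambda>h. ?D (h, 0))) (at s)"
    using diff_chain_at[of "\<lambda>r. (r, u)" "\<lambda>h. (h, 0)" s X ?D] D
    by (simp add: o_def has_derivative_Pair)
  then have "partial_s X p = ?D (1, 0)"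
    unfolding partial_s_def p fst_conv snd_conv
    by (intro vector_derivative_at has_derivative_real_imp_has_vector_derivative)
  moreover have "((\<lambda>r. X (s, r)) has_derivative (\<lambda>h. ?D (0, h))) (at u)"
    using diff_chain_at[of "\<lambda>r. (s, r)" "\<lambda>h. (0, h)" u X ?D] D
    by (simp add: o_def has_derivative_Pair)
  then have "partial_u X p = ?D (0, 1)"
    unfolding partial_u_def p fst_conv snd_conv
    by (intro vector_derivative_at has_derivative_real_imp_has_vector_derivative)
  moreover have "linear ?D"
    using D by (rule has_derivative_linear)
  ultimately have "?D (1, 0) = ?D (0, k)"
    using eq linear_cmul[of ?D k "(0, 1)"] by simp
  then show False
    using inj by (auto dest: injD)
qed

theorem theorem1:
  fixes U :: "(real \<times> real) set"
    and \<beta> w :: "real \<Rightarrow> real^3"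
    and T :: "real set"
    and \<sigma> :: "real \<Rightarrow> real"
    and \<Gamma> :: "real \<Rightarrow> real^3^3"
    and \<Theta> :: "real \<Rightarrow> real^3"
  assumes "open U" and "connected U"
    and "smooth_on (fst ` U) \<beta>" and "smooth_on (fst ` U) w"
    and "immersion_on U (ruled_surface \<beta> w)"
    and "\<And>s. s \<in> fst ` U \<Longrightarrow> norm (w s) = 1"
    and "\<And>s. s \<in> fst ` U \<Longrightarrow> vector_derivative w (at s) \<noteq> 0"
    and "\<And>s. s \<in> fst ` U \<Longrightarrow> vector_derivative \<beta> (at s) \<bullet> vector_derivative w (at s) = 0"
    and "\<And>s. s \<in> fst ` U \<Longrightarrow> norm (vector_derivative w (at s)) = 1"
    and "homothetic_helicoidal_motion T \<sigma> \<Gamma> \<Theta>"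
    and "self_similar_mcf T \<sigma> \<Gamma> \<Theta> U (ruled_surface \<beta> w)"
  shows "minimal_on U (ruled_surface \<beta> w)"
proof -
  define S where "S = fst ` U"
  define \<beta>1 where "\<beta>1 s = frechet_derivative \<beta> (at s) 1" for s
  define \<beta>2 where "\<beta>2 s = frechet_derivative \<beta>1 (at s) 1" for s
  define w1 where "w1 s = frechet_derivative w (at s) 1" for s
  define w2 where "w2 s = frechet_derivative w1 (at s) 1" for s
  define w3 where "w3 s = frechet_derivative w2 (at s) 1" for s
  note \<beta>_smooth = assms(3)[folded S_def] and w_smooth = assms(4)[folded S_def]
  note \<beta>1_smooth = smooth_on_vector_derivative(1)[OF \<beta>_smooth, folded \<beta>1_def]
  note w1_smooth = smooth_on_vector_derivative(1)[OF w_smooth, folded w1_def]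
  note w2_smooth = smooth_on_vector_derivative(1)[OF w1_smooth, folded w2_def]
  note \<beta>_d = smooth_on_vector_derivative(2)[OF \<beta>_smooth, folded \<beta>1_def]
  note \<beta>1_d = smooth_on_vector_derivative(2)[OF \<beta>1_smooth, folded \<beta>2_def]
  note w_d = smooth_on_vector_derivative(2)[OF w_smooth, folded w1_def]
  note w1_d = smooth_on_vector_derivative(2)[OF w1_smooth, folded w2_def]
  note w2_d = smooth_on_vector_derivative(2)[OF w2_smooth, folded w3_def]
  interpret striction_frame S \<beta> \<beta>1 \<beta>2 w w1 w2 w3
  proof
    show "open S"
      unfolding S_def using assms(1) by (rule open_image_fst)
    fix s assume s: "s \<in> S"
    note w_vd = vector_derivative_at[OF w_d[OF s]] and \<beta>_vd = vector_derivative_at[OF \<beta>_d[OF s]]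
    show "w s \<bullet> w s = 1"
      using assms(6) s by (simp add: S_def norm_eq_1)
    show "w1 s \<bullet> w1 s = 1"
      using assms(9)[of s] s w_vd by (simp add: S_def norm_eq_1)
    show "\<beta>1 s \<bullet> w1 s = 0"
      using assms(8)[of s] s w_vd \<beta>_vd by (simp add: S_def)
  qed (use \<beta>_d \<beta>1_d w_d w1_d w2_d in auto)
  let ?X = "ruled_surface \<beta> w"
  \<comment> \<open>\<open>u\<^sup>2 + Q\<^sup>2\<close> is the determinant of the first fundamental form\<close>
  have D: "u\<^sup>2 + (Q s)\<^sup>2 \<noteq> 0" if "(s, u) \<in> U" for s u
  proof
    assume "u\<^sup>2 + (Q s)\<^sup>2 = 0"
    then have "u = 0" "Q s = 0"
      by (simp_all add: sum_power2_eq_zero_iff)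
    moreover have s: "s \<in> S"
      using that by (force simp: S_def)
    ultimately have "partial_s ?X (s, u) = F s *\<^sub>R partial_u ?X (s, u)"
      using \<beta>1_expansion[OF s] by (simp add: partial_s_ruled partial_u_ruled)
    then show False
      using immersion_partials_independent[OF assms(5) that] by blast
  qed
  obtain \<alpha> b c where vel: "\<And>X p. vector_derivative (\<lambda>t. moved_surface \<sigma> \<Gamma> \<Theta> X t p) (at 0 within T)
      = linear_velocity \<alpha> b c (X p)"
    using homothetic_helicoidal_velocity[OF assms(10)] by blast
  have "0 \<in> T"
    using assms(10) by (simp add: homothetic_helicoidal_motion_def)
  then obtain N where N: "unit_normal_on U ?X N"
    and soliton: "\<And>p. p \<in> U \<Longrightarrow> linear_velocity \<alpha> b c (?X p) \<bullet> N p = mean_curvature ?X N p"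
    using assms(11) unfolding self_similar_mcf_def
    by (metis vel moved_surface_initial[OF assms(10)])
  have coeffs: "b \<bullet> w1 s = 0" "linear_velocity \<alpha> b c (\<beta> s) \<bullet> n s = Q s * (b \<bullet> n s)"
    "2 * Q s * (linear_velocity \<alpha> b c (\<beta> s) \<bullet> w1 s) + J s = 0" "Q' s = 0" "Q s * F s = 0"
    if s: "s \<in> S" for s
  proof -
    define I where "I = {u. (s, u) \<in> U}"
    have "open I"
      using open_vimage[OF assms(1), of "\<lambda>u. (s, u)"]
      by (simp add: I_def vimage_def continuous_on_Pair)
    moreover have "I \<noteq> {}"
      using s by (auto simp: S_def I_def)
    ultimately have "infinite I"
      using finite_imp_not_open by blast
    moreover have "(u\<^sup>2 + (Q s)\<^sup>2) * (2 * (Q s * (linear_velocity \<alpha> b c (\<beta> s) \<bullet> w1 s)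
        + u * (Q s * (b \<bullet> n s) - linear_velocity \<alpha> b c (\<beta> s) \<bullet> n s) + u\<^sup>2 * (b \<bullet> w1 s)) + J s)
        + Q s * F s + u * Q' s = 0" if "u \<in> I" for u
    proof -
      have u: "(s, u) \<in> U" using that by (simp add: I_def)
      obtain \<mu> where "\<mu> \<noteq> 0" "N (s, u) = \<mu> *\<^sub>R (Q s *\<^sub>R w1 s - u *\<^sub>R n s)"
        using unit_normal_ruled[OF N u s D[OF u]] by blast
      then show ?thesis
        using velocity_equation[OF _ _ s D[OF u] soliton[OF u]] by blast
    qed
    ultimately have q: "infinite I" "\<And>u. u \<in> I \<Longrightarrow> (u\<^sup>2 + (Q s)\<^sup>2) * (2 * (Q s * (linear_velocity \<alpha> b c (\<beta> s) \<bullet> w1 s)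
        + u * (Q s * (b \<bullet> n s) - linear_velocity \<alpha> b c (\<beta> s) \<bullet> n s) + u\<^sup>2 * (b \<bullet> w1 s)) + J s)
        + Q s * F s + u * Q' s = 0"
      by blast+
    show "b \<bullet> w1 s = 0" "linear_velocity \<alpha> b c (\<beta> s) \<bullet> n s = Q s * (b \<bullet> n s)"
      "2 * Q s * (linear_velocity \<alpha> b c (\<beta> s) \<bullet> w1 s) + J s = 0" "Q' s = 0" "Q s * F s = 0"
      using quartic_coefficients[OF q] by blast+
  qed
  have J: "J s = 0" if "s \<in> S" for s
    using J_zero[OF that coeffs] by blast
  show ?thesis
    unfolding minimal_on_def
  proof (intro allI impI ballI)
    fix M p assume M: "unit_normal_on U ?X M" and "p \<in> U"
    then obtain s u where p: "p = (s, u)" "(s, u) \<in> U" by (cases p) auto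
    then have s: "s \<in> S" by (force simp: S_def)
    obtain \<mu> where "M (s, u) = \<mu> *\<^sub>R (Q s *\<^sub>R w1 s - u *\<^sub>R n s)"
      using unit_normal_ruled[OF M p(2) s D[OF p(2)]] by blast
    then show "mean_curvature ?X M p = 0"
      using mean_curvature_ruled[OF _ s] J[OF s] coeffs(4,5)[OF s] p(1) by simp
  qed
qed

end
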